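(* Let $n\ge 8$ and $m>2(n-6)+10$ be integers. For a positive integer $j$ define $A(j)=2(j-2)+\binom{n-j+1}{2}$. If $r$ is an integer satisfying one of the following conditions: (1) $2\le r<\left\lfloor\frac{n-2}{2}\right\rfloor$ and $A(r+1)+1<m\le A(r)+1$; (2) $r=\left\lfloor\frac{n-2}{2}\right\rfloor$ and $A(r+1)<m\le A(r)+1$; (3) $\left\lfloor\frac{n-2}{2}\right\rfloor<r\le n-5$ and $A(r+1)<m\le A(r)$; then \[ D(n,2,m)=r. \]
   Context: All graphs are finite and simple. For a vertex $u$ of a graph $G$, $N[u]$ is its closed neighborhood (the set consisting of $u$ and all vertices adjacent to $u$). A set $S\subseteq V(G)$ is dominating if every vertex of $G$ lies in $N[s]$ for some $s\in S$. A vertex $u\in V(G)$ is overdominated by $S$ if $|N[u]\cap S|\ge 2$. The cardinality-redundance $CR(S)$ is the number of vertices of $G$ overdominated by $S$, and $CR(G)$ is the minimum of $CR(S)$ over all dominating sets $S$ of $G$. $\gamma_{CR}(G)$ is the minimum size of a dominating set $S$ with $CR(S)=CR(G)$. For integers $n\ge 1$, $0\le k\le n$ and $0\le m\le\binom n2$, $D(n,k,m)$ is the maximum of $\gamma_{CR}(G)$ over all graphs $G$ with $n$ vertices, $m$ edges and $CR(G)=k$; if no such graph exists, $D(n,k,m)=0$. *)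

theory Defs
  imports Main
begin

definition simple_graph :: "'a set \<Rightarrow> 'a set set \<Rightarrow> bool" where
  "simple_graph V E \<longleftrightarrow> finite V \<and> (\<forall>e\<in>E. e \<subseteq> V \<and> card e = 2)"

definition closed_nbhd :: "'a set set \<Rightarrow> 'a \<Rightarrow> 'a set" where
  "closed_nbhd E u = insert u {v. {u, v} \<in> E}"

definition dominating :: "'a set \<Rightarrow> 'a set set \<Rightarrow> 'a set \<Rightarrow> bool" where
  "dominating V E S \<longleftrightarrow> S \<subseteq> V \<and> (\<forall>v\<in>V. \<exists>s\<in>S. v \<in> closed_nbhd E s)"

definition overdominated :: "'a set set \<Rightarrow> 'a set \<Rightarrow> 'a \<Rightarrow> bool" where
  "overdominated E S u \<longleftrightarrow> card (closed_nbhd E u \<inter> S) \<ge> 2"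

definition CR_set :: "'a set \<Rightarrow> 'a set set \<Rightarrow> 'a set \<Rightarrow> nat" where
  "CR_set V E S = card {u \<in> V. overdominated E S u}"

definition CR :: "'a set \<Rightarrow> 'a set set \<Rightarrow> nat" where
  "CR V E = Min (CR_set V E ` {S. dominating V E S})"

definition gamma_CR :: "'a set \<Rightarrow> 'a set set \<Rightarrow> nat" where
  "gamma_CR V E = Min (card ` {S. dominating V E S \<and> CR_set V E S = CR V E})"

text \<open>Vertices are taken from the natural numbers; this is no restriction, by
  \<open>gamma_CR_le_D_CR\<close> below.\<close>

definition gamma_CR_values :: "nat \<Rightarrow> nat \<Rightarrow> nat \<Rightarrow> nat set" where
  "gamma_CR_values n k m =
     {gamma_CR V E | (V :: nat set) E.
        simple_graph V E \<and> card V = n \<and> card E = m \<and> CR V E = k}"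

definition D_CR :: "nat \<Rightarrow> nat \<Rightarrow> nat \<Rightarrow> nat" where
  "D_CR n k m = (if gamma_CR_values n k m = {} then 0 else Max (gamma_CR_values n k m))"

text \<open>Only used for \<open>1 \<le> j \<le> n\<close>, where the subtraction \<open>n - j\<close> does not truncate;
  at \<open>j = 1\<close> the first summand is negative, hence the integer type.\<close>

definition edge_bound :: "nat \<Rightarrow> nat \<Rightarrow> int" where
  "edge_bound n j = 2 * (int j - 2) + int ((n - j + 1) choose 2)"

lemma dominating_self: "dominating V E V"
  by (auto simp: dominating_def closed_nbhd_def)

lemma finite_dominating: "finite V \<Longrightarrow> finite {S. dominating V E S}"
  by (rule finite_subset[of _ "Pow V"]) (auto simp: dominating_def)

lemma CR_attained:
  assumes "finite V"
  obtains S where "dominating V E S" "CR_set V E S = CR V E"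
proof -
  have "CR V E \<in> CR_set V E ` {S. dominating V E S}"
    unfolding CR_def using finite_dominating[OF assms, of E] dominating_self[of V E]
    by (intro Min_in) auto
  then show ?thesis using that by auto
qed

lemma gamma_CR_attained:
  assumes "finite V"
  obtains S where "dominating V E S" "CR_set V E S = CR V E" "card S = gamma_CR V E"
proof -
  obtain S0 where "dominating V E S0" "CR_set V E S0 = CR V E"
    using CR_attained[OF assms] .
  moreover have "finite {S. dominating V E S \<and> CR_set V E S = CR V E}"
    by (rule finite_subset[OF _ finite_dominating[OF assms]]) auto
  ultimately have "gamma_CR V E \<in> card ` {S. dominating V E S \<and> CR_set V E S = CR V E}"
    unfolding gamma_CR_def by (intro Min_in) auto
  then show ?thesis using that by auto
qed

lemma gamma_CR_le_card: "finite V \<Longrightarrow> gamma_CR V E \<le> card V"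
  by (metis gamma_CR_attained dominating_def card_mono)

lemma finite_gamma_CR_values: "finite (gamma_CR_values n k m)"
  by (rule finite_subset[of _ "{..n}"])
     (auto simp: gamma_CR_values_def simple_graph_def gamma_CR_le_card)

context
  fixes V :: "'a set" and E :: "'a set set" and f :: "'a \<Rightarrow> 'b"
  assumes graph: "simple_graph V E" and inj: "inj_on f V"
begin

lemma closed_nbhd_subset: "u \<in> V \<Longrightarrow> closed_nbhd E u \<subseteq> V"
  using graph by (auto simp: closed_nbhd_def simple_graph_def)

lemma inj_image_edges: "inj_on ((`) f) E"
  using graph inj by (auto simp: simple_graph_def inj_on_def inj_on_image_eq_iff)

lemma image_edge_iff:
  assumes "u \<in> V" "v \<in> V"
  shows "{f u, f v} \<in> (`) f ` E \<longleftrightarrow> {u, v} \<in> E"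
proof
  assume "{f u, f v} \<in> (`) f ` E"
  then obtain e where e: "e \<in> E" "f ` {u, v} = f ` e" by auto
  then have "{u, v} = e"
    using assms graph inj_on_image_eq_iff[OF inj, of "{u, v}" e] by (auto simp: simple_graph_def)
  then show "{u, v} \<in> E" using e by simp
next
  assume "{u, v} \<in> E"
  then have "f ` {u, v} \<in> (`) f ` E" by (rule imageI)
  then show "{f u, f v} \<in> (`) f ` E" by simp
qed

lemma simple_graph_image: "simple_graph (f ` V) ((`) f ` E)"
proof -
  have "card (f ` e) = 2" if "e \<in> E" for e
    using that graph inj by (simp add: simple_graph_def card_image inj_on_subset)
  then show ?thesis using graph by (auto simp: simple_graph_def)
qed

lemma closed_nbhd_image:
  assumes u: "u \<in> V"
  shows "closed_nbhd ((`) f ` E) (f u) = f ` closed_nbhd E u"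
proof -
  have "{w. {f u, w} \<in> (`) f ` E} = f ` {v. {u, v} \<in> E}"
  proof (intro equalityI subsetI)
    fix w assume "w \<in> {w. {f u, w} \<in> (`) f ` E}"
    then have w: "{f u, w} \<in> (`) f ` E" by simp
    then have "{f u, w} \<subseteq> f ` V" using simple_graph_image unfolding simple_graph_def by blast
    then obtain v where v: "v \<in> V" "w = f v" by auto
    then have "{u, v} \<in> E" using w image_edge_iff[OF u v(1)] by blast
    then show "w \<in> f ` {v. {u, v} \<in> E}" using v by simp
  next
    fix w assume "w \<in> f ` {v. {u, v} \<in> E}"
    then obtain v where v: "{u, v} \<in> E" "w = f v" by auto
    then have "v \<in> V" using graph by (auto simp: simple_graph_def)
    then show "w \<in> {w. {f u, w} \<in> (`) f ` E}" using v u by (simp add: image_edge_iff)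
  qed
  then show ?thesis by (simp add: closed_nbhd_def)
qed

lemma dominating_image:
  assumes "S \<subseteq> V"
  shows "dominating (f ` V) ((`) f ` E) (f ` S) \<longleftrightarrow> dominating V E S"
proof -
  have "f v \<in> closed_nbhd ((`) f ` E) (f s) \<longleftrightarrow> v \<in> closed_nbhd E s" if "v \<in> V" "s \<in> S" for v s
    using that assms closed_nbhd_subset[of s] inj
    by (auto simp: closed_nbhd_image subset_iff inj_on_def)
  then show ?thesis using assms by (auto simp: dominating_def)
qed

lemma overdominated_image:
  assumes "S \<subseteq> V" "u \<in> V"
  shows "overdominated ((`) f ` E) (f ` S) (f u) \<longleftrightarrow> overdominated E S u"
proof -
  have "f ` closed_nbhd E u \<inter> f ` S = f ` (closed_nbhd E u \<inter> S)"
    using inj_on_image_Int[OF inj closed_nbhd_subset[OF assms(2)] assms(1)] by simp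
  moreover have "card (f ` (closed_nbhd E u \<inter> S)) = card (closed_nbhd E u \<inter> S)"
    using assms by (intro card_image inj_on_subset[OF inj]) auto
  ultimately show ?thesis using assms by (simp add: overdominated_def closed_nbhd_image)
qed

lemma CR_set_image:
  assumes "S \<subseteq> V"
  shows "CR_set (f ` V) ((`) f ` E) (f ` S) = CR_set V E S"
proof -
  have "{u \<in> f ` V. overdominated ((`) f ` E) (f ` S) u} = f ` {u \<in> V. overdominated E S u}"
    using assms by (auto simp: overdominated_image)
  then show ?thesis unfolding CR_set_def
    by (simp add: card_image inj_on_subset[OF inj])
qed

lemma dominating_sets_image:
  "{S. dominating (f ` V) ((`) f ` E) S} = (`) f ` {S. dominating V E S}"
proof (intro equalityI subsetI)
  fix T assume "T \<in> {S. dominating (f ` V) ((`) f ` E) S}"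
  then have T: "dominating (f ` V) ((`) f ` E) T" by simp
  then obtain S where "S \<subseteq> V" "T = f ` S" by (auto simp: dominating_def subset_image_iff)
  then show "T \<in> (`) f ` {S. dominating V E S}" using T dominating_image by auto
next
  fix T assume "T \<in> (`) f ` {S. dominating V E S}"
  then obtain S where S: "dominating V E S" "T = f ` S" by auto
  then have "S \<subseteq> V" by (simp add: dominating_def)
  then show "T \<in> {S. dominating (f ` V) ((`) f ` E) S}"
    using S dominating_image by simp
qed

lemma CR_image: "CR (f ` V) ((`) f ` E) = CR V E"
proof -
  have "CR_set (f ` V) ((`) f ` E) ` {S. dominating (f ` V) ((`) f ` E) S} =
        CR_set V E ` {S. dominating V E S}"
    unfolding dominating_sets_image image_image
    by (rule image_cong) (auto simp: CR_set_image dominating_def)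
  then show ?thesis by (simp add: CR_def)
qed

lemma gamma_CR_image: "gamma_CR (f ` V) ((`) f ` E) = gamma_CR V E"
proof -
  let ?P = "\<lambda>S. dominating V E S \<and> CR_set V E S = CR V E"
  let ?Q = "\<lambda>S. dominating (f ` V) ((`) f ` E) S \<and>
    CR_set (f ` V) ((`) f ` E) S = CR (f ` V) ((`) f ` E)"
  have "{S. ?Q S} = {S \<in> (`) f ` {S. dominating V E S}. CR_set (f ` V) ((`) f ` E) S = CR V E}"
    unfolding dominating_sets_image[symmetric] CR_image by auto
  also have "\<dots> = (`) f ` {S. ?P S}"
    by (auto simp: CR_set_image dominating_def)
  finally have "card ` {S. ?Q S} = (\<lambda>S. card (f ` S)) ` {S. ?P S}"
    by (simp add: image_image)
  also have "\<dots> = card ` {S. ?P S}"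
    by (rule image_cong)
       (auto simp: dominating_def intro!: card_image inj_on_subset[OF inj])
  finally show ?thesis by (simp add: gamma_CR_def)
qed

end

lemma gamma_CR_le_D_CR:
  fixes V :: "'a set"
  assumes "simple_graph V E"
  shows "gamma_CR V E \<le> D_CR (card V) (CR V E) (card E)"
proof -
  have "finite V" using assms by (simp add: simple_graph_def)
  then obtain f :: "'a \<Rightarrow> nat" where f: "inj_on f V"
    using finite_imp_inj_to_nat_seg by blast
  have "gamma_CR (f ` V) ((`) f ` E) \<in> gamma_CR_values (card V) (CR V E) (card E)"
    unfolding gamma_CR_values_def
    using simple_graph_image[OF assms f] CR_image[OF assms f] card_image[OF f]
      card_image[OF inj_image_edges[OF assms f]]
    by blast
  then show ?thesis
    using gamma_CR_image[OF assms f] finite_gamma_CR_values[of "card V" "CR V E" "card E"]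
    by (auto simp: D_CR_def)
qed

end

theory Submission
  imports Defs
begin

text \<open>
  Write \<open>A n j\<close> for \<open>edge_bound n j\<close>. Let \<open>CR V E = 2\<close>, let \<open>S\<close> be a dominating set that
  attains \<open>gamma_CR V E = r\<close>, and let \<open>a\<close>, \<open>b\<close> be the two vertices it overdominates.
  Every other vertex outside \<open>S\<close> has exactly one neighbour in \<open>S\<close>. If \<open>S\<close> contains one of
  \<open>a\<close>, \<open>b\<close>, then \<open>{a, b}\<close> is the only edge inside \<open>S\<close>, and counting gives at most
  \<open>A n r + 1 - 2 * (r - 2)\<close> edges. Otherwise \<open>S\<close> is independent and counting gives at most
  \<open>A n r + 2\<close> edges. That value is never attained, since \<open>a\<close> would be adjacent to all other
  vertices and \<open>CR\<close> would vanish. If only one of the possible edges is missing, it has to be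
  \<open>{a, b}\<close>, because neither \<open>a\<close> nor \<open>b\<close> is universal. When in addition \<open>n < 2 * r + 2\<close>, some
  \<open>s \<in> S\<close> has no neighbours besides \<open>a\<close> and \<open>b\<close>; then \<open>{a, s}\<close> dominates and overdominates
  only \<open>a\<close> and \<open>s\<close>, so that \<open>r \<le> 2\<close>. This is lemma \<open>card_edges_le\<close>: there are at most
  \<open>A n r + 1\<close> edges, and at most \<open>A n r\<close> if \<open>3 \<le> r\<close> and \<open>n < 2 * r + 2\<close>. Since
  \<open>A n j \<le> A n i\<close> for \<open>i \<le> j \<le> n\<close> and \<open>i + 4 \<le> n\<close> (\<open>edge_bound_antimono\<close>), the lower bounds
  on \<open>m\<close> exclude all values of \<open>gamma_CR\<close> above the \<open>r\<close> of the theorem.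

  To attain the value \<open>r\<close>, take an independent set \<open>S\<close> of size \<open>r\<close>, a set \<open>W\<close> of \<open>w = n - r - 2\<close>
  vertices, each with one neighbour in \<open>S\<close>, an arbitrary graph on \<open>W\<close>, and two hubs
  \<open>a\<close>, \<open>b\<close>. A dominating set that avoids both hubs has at least \<open>r\<close> elements, since the
  elements of \<open>S\<close> have disjoint closed neighbourhoods once the hubs are left out. It remains
  to join the hubs to the rest in such a way that every dominating set containing a hub
  overdominates at least three vertices and every other one overdominates both hubs. If
  \<open>r \<le> w\<close>, let every vertex of \<open>S\<close> have a neighbour in \<open>W\<close> and join the hubs to \<open>S \<union> W\<close>, but
  not to each other (\<open>D_CR_ge_nonadjacent_hubs\<close>). If \<open>r \<ge> 3\<close> and \<open>w \<ge> 3\<close>, let a single vertex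
  of \<open>S\<close> be the neighbour of all of \<open>W\<close>, and join the hubs to each other and to all
  vertices except that one (\<open>D_CR_ge_adjacent_hubs\<close>). Varying the graph on \<open>W\<close> produces all
  the required numbers of edges.
\<close>

section \<open>Overdominated vertices\<close>

lemma mem_closed_nbhd: "v \<in> closed_nbhd E u \<longleftrightarrow> v = u \<or> {u, v} \<in> E"
  by (auto simp: closed_nbhd_def)

lemma closed_nbhd_sym: "v \<in> closed_nbhd E u \<longleftrightarrow> u \<in> closed_nbhd E v"
  by (auto simp: mem_closed_nbhd insert_commute)

lemma overdominatedI:
  assumes "finite S" "s \<in> S" "t \<in> S" "s \<noteq> t" "s \<in> closed_nbhd E u" "t \<in> closed_nbhd E u"
  shows "overdominated E S u"
proof -
  have "card {s, t} \<le> card (closed_nbhd E u \<inter> S)"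
    using assms by (intro card_mono) auto
  then show ?thesis using assms by (simp add: overdominated_def)
qed

lemma overdominatedE:
  assumes "overdominated E S u"
  obtains s t where "s \<in> S" "t \<in> S" "s \<noteq> t" "s \<in> closed_nbhd E u" "t \<in> closed_nbhd E u"
proof -
  obtain D where "D \<subseteq> closed_nbhd E u \<inter> S" "card D = 2"
    using assms unfolding overdominated_def by (meson obtain_subset_with_card_n)
  then show ?thesis using that by (auto simp: card_2_iff)
qed

lemma CR_set_ge_card:
  assumes "finite V" "U \<subseteq> V" "\<And>u. u \<in> U \<Longrightarrow> overdominated E S u"
  shows "card U \<le> CR_set V E S"
  unfolding CR_set_def using assms by (intro card_mono) auto

lemma CR_set_small:
  assumes "finite S" "card S \<le> 1"
  shows "CR_set V E S = 0"
proof -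
  have "\<not> overdominated E S u" for u
    using assms by (auto elim!: overdominatedE simp: card_le_Suc0_iff_eq)
  then show ?thesis by (simp add: CR_set_def)
qed

lemma CR_le:
  assumes "finite V" "dominating V E S"
  shows "CR V E \<le> CR_set V E S"
  unfolding CR_def using assms finite_dominating[OF assms(1), of E] by (intro Min_le) auto

lemma gamma_CR_le:
  assumes "finite V" "dominating V E S" "CR_set V E S = CR V E"
  shows "gamma_CR V E \<le> card S"
proof -
  have "finite {S. dominating V E S \<and> CR_set V E S = CR V E}"
    by (rule finite_subset[OF _ finite_dominating[OF assms(1)]]) auto
  then show ?thesis unfolding gamma_CR_def using assms by (intro Min_le) auto
qed

lemma not_universal:
  assumes "finite V" "a \<in> V" "CR V E > 0"
  obtains v where "v \<in> V" "v \<noteq> a" "{a, v} \<notin> E"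
proof -
  have "\<not> dominating V E {a}"
    using CR_le[OF assms(1), of E "{a}"] CR_set_small[of "{a}" V E] assms(3) by auto
  then obtain v where "v \<in> V" "v \<notin> closed_nbhd E a"
    using assms(2) by (auto simp: dominating_def)
  then show ?thesis using that by (auto simp: mem_closed_nbhd)
qed

section \<open>The largest number of edges\<close>

lemma unique_dominator:
  assumes "finite S" "dominating V E S" "v \<in> V - S" "\<not> overdominated E S v"
  shows "\<exists>p. {s \<in> S. {s, v} \<in> E} = {p}"
proof -
  obtain p where p: "p \<in> S" "{p, v} \<in> E"
    using assms by (auto simp: dominating_def mem_closed_nbhd)
  have "s = p" if "s \<in> S" "{s, v} \<in> E" for s
    using overdominatedI[OF assms(1) that(1) p(1), of E v] that p assms(4)
    by (auto simp: mem_closed_nbhd insert_commute)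
  then show ?thesis using p by blast
qed

text \<open>A form free of truncated subtraction and binomial coefficients.\<close>

lemma edge_bound_int:
  "j \<le> n \<Longrightarrow> 2 * edge_bound n j = 4 * (int j - 2) + (int n - int j + 1) * (int n - int j)"
proof (induction n rule: dec_induct)
  case base
  then show ?case by (simp add: edge_bound_def)
next
  case (step n)
  then have "Suc n - j + 1 = Suc (n - j + 1)" by simp
  then show ?case using step
    by (simp add: edge_bound_def numeral_2_eq_2 algebra_simps of_nat_diff)
qed

text \<open>The bound is not antitone in \<open>j\<close> on the whole range \<open>j \<le> n\<close>: it increases by one from
  \<open>n - 1\<close> to \<open>n\<close>. This does no harm as long as \<open>i \<le> n - 4\<close>.\<close>

lemma edge_bound_antimono:
  assumes "i \<le> j" "j \<le> n" "i + 4 \<le> n"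
  shows "edge_bound n j \<le> edge_bound n i"
proof -
  have "0 \<le> (int j - int i) * ((int n - int i) + (int n - int j) - 3)"
    using assms by (intro mult_nonneg_nonneg) auto
  also have "\<dots> = 2 * edge_bound n i - 2 * edge_bound n j"
    using assms edge_bound_int[of i n] edge_bound_int[of j n] by (simp add: algebra_simps)
  finally show ?thesis by simp
qed

lemma edge_bound_outside:
  assumes "r \<le> n"
  shows "edge_bound n r = 2 * (int r - 2) + int ((n - r) choose 2) + int (n - r)"
  by (simp add: edge_bound_def numeral_2_eq_2)

text \<open>The subtracted term \<open>2 * (card S - 2)\<close> is nonnegative, and positive as soon as \<open>card S \<ge> 3\<close>.\<close>

lemma edges_bound_overdominated_inside:
  assumes g: "simple_graph V E" and dom: "dominating V E S"
    and cr: "CR_set V E S = 2" and u: "u \<in> S" "overdominated E S u"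
  shows "int (card E) \<le> edge_bound (card V) (card S) + 1 - 2 * (int (card S) - 2)"
    and "2 \<le> card S"
proof -
  let ?O = "{u \<in> V. overdominated E S u}"
  have fin: "finite V" and SV: "S \<subseteq> V" using g dom by (auto simp: simple_graph_def dominating_def)
  then have finS: "finite S" by (blast intro: finite_subset)
  have edge: "x \<in> ?O \<and> y \<in> ?O" if "{x, y} \<in> E" "x \<in> S" "y \<in> S" "x \<noteq> y" for x y
    using that SV overdominatedI[OF finS, of x y E x] overdominatedI[OF finS, of x y E y]
    by (auto simp: mem_closed_nbhd insert_commute)
  obtain t where t: "t \<in> S" "t \<noteq> u" "{u, t} \<in> E"
    using u(2) unfolding mem_closed_nbhd by (metis overdominatedE mem_closed_nbhd)
  have "card ?O = card {u, t}" using cr t by (simp add: CR_set_def)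
  moreover have "{u, t} \<subseteq> ?O" using edge[OF t(3)] t u by auto
  moreover have "finite ?O" using fin by simp
  ultimately have O: "?O = {u, t}" using card_subset_eq[of ?O "{u, t}"] by simp
  have "\<forall>v\<in>V - S. \<exists>p. {s \<in> S. {s, v} \<in> E} = {p}"
  proof
    fix v assume v: "v \<in> V - S"
    then have "v \<notin> ?O" using O u t by auto
    then show "\<exists>p. {s \<in> S. {s, v} \<in> E} = {p}"
      using unique_dominator[OF finS dom v] v by auto
  qed
  then obtain p where p: "\<forall>v\<in>V - S. {s \<in> S. {s, v} \<in> E} = {p v}" by metis
  let ?K = "{e. e \<subseteq> V - S \<and> card e = 2}"
  have "E \<subseteq> insert {u, t} (?K \<union> (\<lambda>v. {p v, v}) ` (V - S))"
  proof
    fix e assume e: "e \<in> E"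
    then have eV: "e \<subseteq> V" "card e = 2" using g by (auto simp: simple_graph_def)
    show "e \<in> insert {u, t} (?K \<union> (\<lambda>v. {p v, v}) ` (V - S))"
    proof (cases "e \<inter> S = {}")
      case False
      then obtain x y where xy: "e = {x, y}" "x \<noteq> y" "x \<in> S" "y \<in> V"
        using eV by (auto simp: card_2_iff insert_commute)
      show ?thesis
      proof (cases "y \<in> S")
        case True
        then have "x \<in> {u, t}" "y \<in> {u, t}" using edge[of x y] xy e unfolding O by auto
        then have "e = {u, t}" using xy by auto
        then show ?thesis by simp
      next
        case False
        then have "x \<in> {p y}" using p xy e by blast
        then show ?thesis using xy False by auto
      qed
    qed (use eV in auto)
  qed
  then have "card E \<le> card (insert {u, t} (?K \<union> (\<lambda>v. {p v, v}) ` (V - S)))"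
    using fin by (intro card_mono) auto
  also have "\<dots> \<le> Suc (card (?K \<union> (\<lambda>v. {p v, v}) ` (V - S)))" by (rule card_insert_le_m1) auto
  also have "\<dots> \<le> Suc (card ?K + card (V - S))"
    using card_Un_le[of ?K "(\<lambda>v. {p v, v}) ` (V - S)"]
      card_image_le[of "V - S" "\<lambda>v. {p v, v}"] fin by simp
  also have "\<dots> = Suc (((card V - card S) choose 2) + (card V - card S))"
    using fin finS SV by (simp add: n_subsets card_Diff_subset)
  finally show "int (card E) \<le> edge_bound (card V) (card S) + 1 - 2 * (int (card S) - 2)"
    using card_mono[OF fin SV] by (simp add: edge_bound_outside)
  show "2 \<le> card S" using card_mono[of S "{u, t}"] t u finS by simp
qed

text \<open>The case in which both overdominated vertices lie outside \<open>S\<close>. The second bound is where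
  minimality is used: the pigeonhole principle provides an \<open>s \<in> S\<close> that dominates nothing
  privately, and \<open>{a, s}\<close> is then as good as \<open>S\<close>.\<close>

lemma edges_bound_overdominated_outside:
  assumes g: "simple_graph V E" and CR: "CR V E = 2" and dom: "dominating V E S"
    and cr: "CR_set V E S = 2" and outside: "\<And>u. u \<in> S \<Longrightarrow> \<not> overdominated E S u"
  shows "int (card E) \<le> edge_bound (card V) (card S) + 1"
    and "3 \<le> gamma_CR V E \<Longrightarrow> card V < 2 * card S + 2 \<Longrightarrow>
         int (card E) \<le> edge_bound (card V) (card S)"
proof -
  let ?O = "{u \<in> V. overdominated E S u}"
  have fin: "finite V" and SV: "S \<subseteq> V" using g dom by (auto simp: simple_graph_def dominating_def)
  then have finS: "finite S" by (blast intro: finite_subset)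
  have indep: "{x, y} \<notin> E" if "x \<in> S" "y \<in> S" "x \<noteq> y" for x y
    using that outside overdominatedI[OF finS, of x y E x] by (auto simp: mem_closed_nbhd)
  obtain a b where O: "?O = {a, b}" "a \<noteq> b" using cr by (auto simp: CR_set_def card_2_iff)
  then have ab: "a \<in> V - S" "b \<in> V - S" using outside by blast+
  let ?W = "V - S - {a, b}"
  have "\<forall>v\<in>?W. \<exists>p. {s \<in> S. {s, v} \<in> E} = {p}"
  proof
    fix v assume v: "v \<in> ?W"
    then have "v \<notin> ?O" unfolding O by auto
    then show "\<exists>p. {s \<in> S. {s, v} \<in> E} = {p}"
      using unique_dominator[OF finS dom, of v] v by auto
  qed
  then obtain p where p: "\<forall>v\<in>?W. {s \<in> S. {s, v} \<in> E} = {p v}" by metis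
  let ?K = "{e. e \<subseteq> V - S \<and> card e = 2}"
  \<comment> \<open>All the edges that are compatible with the domination pattern of \<open>S\<close>.\<close>
  define B where "B = ?K \<union> (\<lambda>v. {a, v}) ` S \<union> (\<lambda>v. {b, v}) ` S \<union> (\<lambda>v. {p v, v}) ` ?W"
  have finB: "finite B" unfolding B_def using fin finS by auto
  have EB: "E \<subseteq> B"
  proof
    fix e assume e: "e \<in> E"
    then have eV: "e \<subseteq> V" "card e = 2" using g by (auto simp: simple_graph_def)
    show "e \<in> B"
    proof (cases "e \<inter> S = {}")
      case False
      then obtain x y where xy: "e = {x, y}" "x \<noteq> y" "x \<in> S" "y \<in> V"
        using eV by (auto simp: card_2_iff insert_commute)
      then have yS: "y \<notin> S" using indep e by blast
      show ?thesis
      proof (cases "y \<in> {a, b}")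
        case True
        then show ?thesis using xy unfolding B_def by (auto simp: insert_commute)
      next
        case False
        then have "x \<in> {p y}" using p xy e yS by blast
        then show ?thesis using xy False yS unfolding B_def by auto
      qed
    qed (use eV in \<open>auto simp: B_def\<close>)
  qed
  have cW: "card ?W + 2 = card V - card S"
  proof -
    have "card {a, b} \<le> card (V - S)" using ab fin by (intro card_mono) auto
    then show ?thesis using O ab fin finS SV by (simp add: card_Diff_subset)
  qed
  have "card B \<le> card ?K + card S + card S + card ?W"
    unfolding B_def
    by (rule order_trans[OF card_Un_le] add_mono card_image_le finS order_refl
        finite_Diff fin)+
  also have "card ?K = (card V - card S) choose 2"
    using fin finS SV by (simp add: n_subsets card_Diff_subset)
  finally have cB: "int (card B) \<le> edge_bound (card V) (card S) + 2"
    using cW card_mono[OF fin SV] by (simp add: edge_bound_outside)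
  have cE: "card E + card (B - E) = card B"
    using EB finB card_mono[OF finB EB] by (simp add: card_Diff_subset finite_subset)
  have missing: "\<exists>v. v \<in> V \<and> v \<noteq> c \<and> {c, v} \<in> B - E" if c: "c \<in> {a, b}" for c
  proof -
    obtain v where v: "v \<in> V" "v \<noteq> c" "{c, v} \<notin> E"
      using not_universal[OF fin, of c E] c ab CR by auto
    moreover have "{c, v} \<in> B" using v c ab unfolding B_def by (cases "v \<in> S") auto
    ultimately show ?thesis by blast
  qed
  obtain x where x: "x \<in> V" "x \<noteq> a" "{a, x} \<in> B - E" using missing[of a] by auto
  obtain y where y: "y \<in> V" "y \<noteq> b" "{b, y} \<in> B - E" using missing[of b] by auto
  have "card {{a, x}} \<le> card (B - E)" using x finB by (intro card_mono) auto
  then have "card (B - E) \<ge> 1" by simp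
  then show "int (card E) \<le> edge_bound (card V) (card S) + 1" using cB cE by linarith
  assume g3: "3 \<le> gamma_CR V E" and r: "card V < 2 * card S + 2"
  have "card (B - E) \<ge> 2"
  proof (rule ccontr)
    assume "\<not> card (B - E) \<ge> 2"
    then have le1: "card (B - E) \<le> Suc 0" by simp
    \<comment> \<open>Only one edge is missing, and it makes both \<open>a\<close> and \<open>b\<close> non-universal.\<close>
    have uniq: "e = e'" if "e \<in> B - E" "e' \<in> B - E" for e e'
      using le1 that finB by (auto simp: card_le_Suc0_iff_eq)
    have "{a, x} = {b, y}" using x y uniq by blast
    then have abE: "{a, b} \<in> B - E" using x O(2) by (auto simp: doubleton_eq_iff)
    have allE: "{a, v} \<in> E" if "v \<in> V" "v \<noteq> a" "v \<noteq> b" for v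
    proof (rule ccontr)
      assume "{a, v} \<notin> E"
      moreover have "{a, v} \<in> B" using that ab unfolding B_def by (cases "v \<in> S") auto
      ultimately have "{a, v} = {a, b}" using uniq abE by blast
      then show False using that by (auto simp: doubleton_eq_iff)
    qed
    \<comment> \<open>There are too few vertices in \<open>?W\<close> for each element of \<open>S\<close> to be the dominator of one.\<close>
    have "card (p ` ?W) < card S"
      using card_image_le[of ?W p] fin cW r by simp
    then obtain s where s: "s \<in> S" "s \<notin> p ` ?W"
      using fin by (metis card_mono finite_Diff finite_imageI linorder_not_less subsetI)
    have sb: "{s, b} \<in> E"
    proof (rule ccontr)
      assume "{s, b} \<notin> E"
      moreover have "{s, b} \<in> B" using s unfolding B_def by auto
      ultimately have "{s, b} = {a, b}" using uniq abE by blast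
      then show False using s ab O by (auto simp: doubleton_eq_iff)
    qed
    have as: "a \<noteq> s" "s \<in> V" "s \<noteq> b" using s ab SV by auto
    have dom2: "dominating V E {a, s}"
      unfolding dominating_def
    proof (intro conjI ballI)
      fix v assume "v \<in> V"
      then have "v \<in> closed_nbhd E a \<or> v \<in> closed_nbhd E s"
        using allE[of v] sb unfolding mem_closed_nbhd by blast
      then show "\<exists>t\<in>{a, s}. v \<in> closed_nbhd E t" by blast
    qed (use as ab in blast)
    have "{u \<in> V. overdominated E {a, s} u} \<subseteq> {a, s}"
    proof (intro subsetI)
      fix u assume "u \<in> {u \<in> V. overdominated E {a, s} u}"
      then have u: "u \<in> V" "a \<in> closed_nbhd E u" "s \<in> closed_nbhd E u"
        by (auto elim!: overdominatedE)
      show "u \<in> {a, s}"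
      proof (rule ccontr)
        assume n: "u \<notin> {a, s}"
        then have us: "{s, u} \<in> E" "{a, u} \<in> E"
          using u by (auto simp: mem_closed_nbhd insert_commute)
        then have "u \<notin> S" "u \<noteq> b" using indep[of s u] s n abE by auto
        then have uW: "u \<in> ?W" using u n by auto
        then have "s \<in> {p u}" using p us s by blast
        then show False using s uW by auto
      qed
    qed
    then have "CR_set V E {a, s} \<le> card {a, s}"
      unfolding CR_set_def by (intro card_mono) auto
    then have "CR_set V E {a, s} = CR V E"
      using CR_le[OF fin dom2] CR as by simp
    then have "gamma_CR V E \<le> card {a, s}" by (rule gamma_CR_le[OF fin dom2])
    then show False using g3 as by simp
  qed
  then show "int (card E) \<le> edge_bound (card V) (card S)" using cB cE by linarith
qed

lemma card_edges_le:
  assumes g: "simple_graph V E" and CR: "CR V E = 2"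
  shows "int (card E) \<le> edge_bound (card V) (gamma_CR V E) + 1"
    and "3 \<le> gamma_CR V E \<Longrightarrow> card V < 2 * gamma_CR V E + 2 \<Longrightarrow>
         int (card E) \<le> edge_bound (card V) (gamma_CR V E)"
proof -
  have fin: "finite V" using g by (simp add: simple_graph_def)
  obtain S where S: "dominating V E S" "CR_set V E S = 2" "card S = gamma_CR V E"
    using gamma_CR_attained[OF fin, of E] CR by metis
  have "int (card E) \<le> edge_bound (card V) (card S) + 1 \<and> (3 \<le> gamma_CR V E \<longrightarrow>
    card V < 2 * card S + 2 \<longrightarrow> int (card E) \<le> edge_bound (card V) (card S))"
  proof (cases "\<exists>u\<in>S. overdominated E S u")
    case True
    then show ?thesis using edges_bound_overdominated_inside[OF g S(1,2)] S(3) by force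
  next
    case False
    then show ?thesis using edges_bound_overdominated_outside[OF g CR S(1,2)] by blast
  qed
  then show "int (card E) \<le> edge_bound (card V) (gamma_CR V E) + 1"
    and "3 \<le> gamma_CR V E \<Longrightarrow> card V < 2 * gamma_CR V E + 2 \<Longrightarrow>
         int (card E) \<le> edge_bound (card V) (gamma_CR V E)"
    using S(3) by auto
qed

section \<open>Graphs with two hubs\<close>

text \<open>The vertices are \<open>S\<close>, \<open>W\<close> and the two hubs \<open>a\<close>, \<open>b\<close>. Each hub is joined to all of \<open>X\<close>, and
  \<open>w \<in> W\<close> is joined to \<open>f w \<in> S\<close>, its only neighbour in \<open>S\<close>. The remaining edges \<open>F\<close> lie inside
  \<open>W\<close>, except that \<open>{a, b}\<close> may be one of them.\<close>

locale two_hubs =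
  fixes S W X :: "'a set" and f :: "'a \<Rightarrow> 'a" and F :: "'a set set" and a b :: 'a
  assumes finite: "finite S" "finite W"
    and disjoint: "S \<inter> W = {}"
    and hubs: "a \<noteq> b" "a \<notin> S \<union> W" "b \<notin> S \<union> W"
    and W_subset: "W \<subseteq> X" and X_subset: "X \<subseteq> S \<union> W"
    and parent: "\<And>w. w \<in> W \<Longrightarrow> f w \<in> S"
    and extra: "F \<subseteq> insert {a, b} {e. e \<subseteq> W \<and> card e = 2}"
    and two_joined: "2 \<le> card (S \<inter> X)"
begin

text \<open>The vertex set of the graph.\<close>

definition verts :: "'a set" where "verts = S \<union> W \<union> {a, b}"

text \<open>The edge set of the graph; by the locale assumptions the four parts are disjoint.\<close>

definition edges :: "'a set set" where
  "edges = (\<lambda>v. {a, v}) ` X \<union> (\<lambda>v. {b, v}) ` X \<union> (\<lambda>w. {w, f w}) ` W \<union> F"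

lemma finite_verts: "finite verts" and finite_X: "finite X"
  using finite X_subset by (auto simp: verts_def intro: finite_subset)

lemma edge_kinds:
  assumes "e \<in> edges"
  obtains c v where "c \<in> {a, b}" "v \<in> X" "e = {c, v}" | w where "w \<in> W" "e = {w, f w}"
    | "e = {a, b}" "{a, b} \<in> F" | "e \<subseteq> W" "card e = 2"
proof -
  have "(\<exists>c\<in>{a, b}. \<exists>v\<in>X. e = {c, v}) \<or> (\<exists>w\<in>W. e = {w, f w}) \<or> e \<in> F"
    using assms unfolding edges_def by auto
  then show ?thesis using that extra by blast
qed

lemma simple_graph_two_hubs: "simple_graph verts edges"
proof -
  have "e \<subseteq> verts \<and> card e = 2" if "e \<in> edges" for e
    using that
  proof (cases rule: edge_kinds)
    case (1 c v)
    then have "v \<in> S \<union> W" "c \<noteq> v" using X_subset hubs by auto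
    then show ?thesis using 1 by (auto simp: verts_def)
  next
    case (2 w)
    then have "f w \<in> S" "w \<noteq> f w" using parent[of w] disjoint by auto
    then show ?thesis using 2 by (auto simp: verts_def)
  qed (use hubs in \<open>auto simp: verts_def\<close>)
  then show ?thesis using finite_verts by (simp add: simple_graph_def)
qed

lemma card_verts: "card verts = card S + card W + 2"
proof -
  have "card verts = card (S \<union> W) + card {a, b}"
    unfolding verts_def using finite hubs by (intro card_Un_disjoint) auto
  then show ?thesis using finite disjoint hubs by (simp add: card_Un_disjoint)
qed

lemma card_edges: "card edges = 2 * card X + card W + card F"
proof -
  have ab: "v \<noteq> a \<and> v \<noteq> b" if "v \<in> X" for v using that X_subset hubs by auto
  have inj: "inj_on (\<lambda>v. {a, v}) X" "inj_on (\<lambda>v. {b, v}) X" "inj_on (\<lambda>w. {w, f w}) W"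
    using ab disjoint parent by (auto simp: inj_on_def doubleton_eq_iff)
  have finF: "finite F" using extra by (rule finite_subset) (simp add: finite)
  have 1: "(\<lambda>v. {a, v}) ` X \<inter> (\<lambda>v. {b, v}) ` X = {}"
    using ab hubs by (auto simp: doubleton_eq_iff)
  have 2: "((\<lambda>v. {a, v}) ` X \<union> (\<lambda>v. {b, v}) ` X) \<inter> (\<lambda>w. {w, f w}) ` W = {}"
    using hubs parent by (fastforce simp: doubleton_eq_iff)
  have F: "e \<noteq> {a, v}" "e \<noteq> {b, v}" if "e \<in> F" "v \<in> X" for e v
    using that extra ab hubs by (auto simp: doubleton_eq_iff)
  have "e \<noteq> {w, f w}" if "e \<in> F" "w \<in> W" for e w
  proof
    assume "e = {w, f w}"
    moreover have "e = {a, b} \<or> e \<subseteq> W" using that extra by auto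
    ultimately show False using that hubs disjoint parent[of w] by (auto simp: doubleton_eq_iff)
  qed
  then have 3: "((\<lambda>v. {a, v}) ` X \<union> (\<lambda>v. {b, v}) ` X \<union> (\<lambda>w. {w, f w}) ` W) \<inter> F = {}"
    using F by blast
  show ?thesis
    unfolding edges_def using 1 2 3 finite finite_X finF
    by (simp add: card_Un_disjoint card_image inj)
qed

lemma hub_joined: "c \<in> {a, b} \<Longrightarrow> v \<in> X \<Longrightarrow> {c, v} \<in> edges"
  by (auto simp: edges_def)

lemma joined_parent: "w \<in> W \<Longrightarrow> {w, f w} \<in> edges"
  by (auto simp: edges_def)

lemma edge_cases:
  assumes "{u, v} \<in> edges"
  obtains "u \<in> {a, b}" "v \<in> X" | "v \<in> {a, b}" "u \<in> X" | "u \<in> W" "v = f u" | "v \<in> W" "u = f v"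
    | "u \<in> W" "v \<in> W" | "{u, v} = {a, b}" "{a, b} \<in> F"
  using assms
proof (cases rule: edge_kinds)
  case (1 c x)
  then show ?thesis using that(1,2) by (auto simp: doubleton_eq_iff)
next
  case (2 w)
  then show ?thesis using that(3,4) by (auto simp: doubleton_eq_iff)
next
  case 3
  then show ?thesis using that(6) by blast
next
  case 4
  then show ?thesis using that(5) by blast
qed

lemma independent_nbhd:
  assumes "s \<in> S" "v \<in> closed_nbhd edges s"
  shows "v = s \<or> v \<in> {a, b} \<and> s \<in> X \<or> v \<in> W \<and> f v = s"
proof (cases "v = s")
  case False
  then have "{s, v} \<in> edges" using assms by (simp add: mem_closed_nbhd)
  then show ?thesis
    using assms(1) hubs disjoint by (cases rule: edge_cases) (auto simp: doubleton_eq_iff)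
qed simp

text \<open>The map sending \<open>w \<in> W\<close> to \<open>f w\<close> and fixing \<open>S\<close> maps such a dominating set onto \<open>S\<close>.\<close>

lemma card_dominating_ge:
  assumes dom: "dominating verts edges T" and "a \<notin> T" "b \<notin> T"
  shows "card S \<le> card T"
proof -
  let ?g = "\<lambda>v. if v \<in> W then f v else v"
  have "finite T" using dom finite_verts by (auto simp: dominating_def intro: finite_subset)
  moreover have "S \<subseteq> ?g ` T"
  proof
    fix s assume s: "s \<in> S"
    then obtain t where t: "t \<in> T" "s \<in> closed_nbhd edges t"
      using dom by (auto simp: dominating_def verts_def)
    then have "t = s \<or> t \<in> W \<and> f t = s"
      using independent_nbhd[OF s, of t] assms(2,3) closed_nbhd_sym[of t edges s] by auto
    then have "s = ?g t" using s disjoint by auto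
    then show "s \<in> ?g ` T" using t by blast
  qed
  ultimately show ?thesis by (rule surj_card_le)
qed

lemma dominating_S: "dominating verts edges S"
proof -
  obtain s where s: "s \<in> S \<inter> X" using two_joined by (cases "S \<inter> X = {}") auto
  have "\<exists>s\<in>S. v \<in> closed_nbhd edges s" if v: "v \<in> verts" for v
  proof -
    consider "v \<in> S" | "v \<in> W" | "v \<in> {a, b}" using v unfolding verts_def by blast
    then show ?thesis
    proof cases
      case 2
      then show ?thesis using joined_parent[of v] parent[of v]
        by (auto simp: mem_closed_nbhd insert_commute intro!: bexI[of _ "f v"])
    next
      case 3
      then show ?thesis using s hub_joined[of v s] by (auto simp: mem_closed_nbhd insert_commute)
    qed (auto simp: mem_closed_nbhd)
  qed
  then show ?thesis by (auto simp: dominating_def verts_def)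
qed

lemma hub_overdominated:
  assumes "c \<in> {a, b}" "finite T" "2 \<le> card (T \<inter> X)"
  shows "overdominated edges T c"
proof -
  have "T \<inter> X \<subseteq> closed_nbhd edges c \<inter> T"
    using hub_joined[OF assms(1)] by (auto simp: mem_closed_nbhd)
  then have "card (T \<inter> X) \<le> card (closed_nbhd edges c \<inter> T)"
    using assms(2) by (intro card_mono) auto
  then show ?thesis using assms(3) by (simp add: overdominated_def)
qed

lemma CR_set_S: "CR_set verts edges S = 2"
proof -
  have "\<not> overdominated edges S u" if u: "u \<in> S \<union> W" for u
  proof
    assume "overdominated edges S u"
    then obtain s t where st: "s \<in> S" "t \<in> S" "s \<noteq> t" "u \<in> closed_nbhd edges s"
      "u \<in> closed_nbhd edges t"
      by (metis overdominatedE closed_nbhd_sym)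
    then show False
      using independent_nbhd[OF st(1,4)] independent_nbhd[OF st(2,5)] u hubs disjoint by auto
  qed
  then have "{u \<in> verts. overdominated edges S u} = {a, b}"
    using hub_overdominated[OF _ finite(1)] two_joined by (auto simp: verts_def)
  then show ?thesis using hubs by (simp add: CR_set_def)
qed

text \<open>If every dominating set with a hub overdominates three vertices, only dominating sets
  without hubs can be optimal, and these have at least \<open>card S\<close> elements. The second
  assumption excludes that they overdominate fewer than the two hubs.\<close>

lemma two_hubs_D_CR:
  assumes costly: "\<And>T c. dominating verts edges T \<Longrightarrow> c \<in> {a, b} \<Longrightarrow> c \<in> T \<Longrightarrow>
      3 \<le> CR_set verts edges T"
    and joined: "\<And>T. dominating verts edges T \<Longrightarrow> a \<notin> T \<Longrightarrow> b \<notin> T \<Longrightarrow> 2 \<le> card (T \<inter> X)"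
  shows "card S \<le> D_CR (card S + card W + 2) 2 (2 * card X + card W + card F)"
proof -
  have ge2: "2 \<le> CR_set verts edges T" if T: "dominating verts edges T" for T
  proof (cases "a \<in> T \<or> b \<in> T")
    case True
    then show ?thesis using costly[OF T, of a] costly[OF T, of b] by auto
  next
    case False
    have "finite T" using T finite_verts by (auto simp: dominating_def intro: finite_subset)
    then have "card {a, b} \<le> CR_set verts edges T"
      using False joined[OF T] hub_overdominated[of _ T] finite_verts
      by (intro CR_set_ge_card) (auto simp: verts_def)
    then show ?thesis using hubs by simp
  qed
  have CR2: "CR verts edges = 2"
    using CR_le[OF finite_verts dominating_S] CR_set_S CR_attained[OF finite_verts, of edges] ge2
    by (metis le_antisym)
  obtain T where T: "dominating verts edges T" "CR_set verts edges T = 2"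
    "card T = gamma_CR verts edges"
    using gamma_CR_attained[OF finite_verts, of edges] CR2 by metis
  then have "a \<notin> T" "b \<notin> T" using costly[OF T(1), of a] costly[OF T(1), of b] by auto
  then have "card S \<le> gamma_CR verts edges" using card_dominating_ge[OF T(1)] T(3) by simp
  also have "\<dots> \<le> D_CR (card verts) (CR verts edges) (card edges)"
    by (rule gamma_CR_le_D_CR[OF simple_graph_two_hubs])
  finally show ?thesis by (simp add: CR2 card_verts card_edges)
qed

end

text \<open>Every element of \<open>S\<close> has a neighbour in \<open>W\<close>. Suppose that a dominating set contains only the
  hub \<open>c\<close>. It needs some \<open>t \<in> S \<union> W\<close> to dominate the other hub, and \<open>c\<close> and \<open>t\<close> both dominate
  \<open>c\<close> and the two ends of an edge between \<open>S\<close> and \<open>W\<close> that contains \<open>t\<close>.\<close>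

lemma D_CR_ge_nonadjacent_hubs:
  fixes r w e :: nat
  assumes r: "2 \<le> r" and w: "r \<le> w" and e: "e \<le> w choose 2"
  shows "r \<le> D_CR (r + w + 2) 2 (2 * r + 3 * w + e)"
proof -
  define S W where "S = {..<r}" and "W = {r..<r + w}"
  define f where "f v = (v - r) mod r" for v
  define a b where "a = r + w" and "b = Suc (r + w)"
  have "e \<le> card {x. x \<subseteq> W \<and> card x = 2}" using e by (simp add: n_subsets W_def)
  then obtain F where F: "F \<subseteq> {x. x \<subseteq> W \<and> card x = 2}" "card F = e"
    by (meson obtain_subset_with_card_n)
  interpret two_hubs S W "S \<union> W" f F a b
  proof
    show "F \<subseteq> insert {a, b} {e. e \<subseteq> W \<and> card e = 2}" using F by auto
  qed (use r in \<open>auto simp: S_def W_def f_def a_def b_def Int_absorb2\<close>)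
  have fin: "finite T" if "dominating verts edges T" for T
    using that finite_verts by (auto simp: dominating_def intro: finite_subset)
  have surj: "\<exists>w\<in>W. f w = s" if "s \<in> S" for s
    using that w by (intro bexI[of _ "r + s"]) (auto simp: S_def W_def f_def)
  have nonadj: "{a, b} \<notin> F" using F hubs by auto
  have "card S \<le> D_CR (card S + card W + 2) 2 (2 * card (S \<union> W) + card W + card F)"
  proof (rule two_hubs_D_CR)
    fix T c assume T: "dominating verts edges T" and c: "c \<in> {a, b}" "c \<in> T"
    obtain d where d: "{c, d} = {a, b}" "d \<noteq> c" using c hubs by auto
    then have dab: "d \<in> {a, b}" by auto
    show "3 \<le> CR_set verts edges T"
    proof (cases "d \<in> T")
      case True
      have "card (S \<union> W) \<le> CR_set verts edges T"
      proof (rule CR_set_ge_card[OF finite_verts])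
        fix u assume "u \<in> S \<union> W"
        then show "overdominated edges T u"
          using overdominatedI[OF fin[OF T] c(2) True, of edges u] d(2)
            hub_joined[OF c(1), of u] hub_joined[OF dab, of u]
          by (auto simp: mem_closed_nbhd insert_commute)
      qed (auto simp: verts_def)
      moreover have "card (S \<union> W) = r + w"
        using disjoint finite by (simp add: card_Un_disjoint S_def W_def)
      ultimately show ?thesis using r w by simp
    next
      case False
      have "d \<in> verts" using dab by (auto simp: verts_def)
      then obtain t where t: "t \<in> T" "d \<in> closed_nbhd edges t"
        using T by (auto simp: dominating_def)
      then have td: "{t, d} \<in> edges" using False by (auto simp: mem_closed_nbhd)
      have tX: "t \<in> S \<union> W"
        using td nonadj dab hubs parent by (cases rule: edge_cases) auto
      \<comment> \<open>The vertex \<open>t\<close> is an end of an edge whose two ends are joined to \<open>c\<close>.\<close>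
      then obtain w where w: "w \<in> W" "t \<in> {w, f w}" using surj by blast
      have fw: "f w \<in> S" using parent w by auto
      have ne: "c \<noteq> w" "c \<noteq> f w" "w \<noteq> f w" "c \<noteq> t"
        using w fw tX c hubs disjoint by auto
      have "card {c, w, f w} \<le> CR_set verts edges T"
      proof (rule CR_set_ge_card[OF finite_verts])
        show "{c, w, f w} \<subseteq> verts" using c w fw by (auto simp: verts_def)
        fix u assume u: "u \<in> {c, w, f w}"
        have "c \<in> closed_nbhd edges u" "t \<in> closed_nbhd edges u"
          using u w fw hub_joined[OF c(1), of w] hub_joined[OF c(1), of "f w"]
            joined_parent[of w]
          by (auto simp: mem_closed_nbhd insert_commute)
        then show "overdominated edges T u"
          by (rule overdominatedI[OF fin[OF T] c(2) t(1) ne(4)])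
      qed
      then show ?thesis using ne by simp
    qed
  next
    fix T assume T: "dominating verts edges T" "a \<notin> T" "b \<notin> T"
    then have "T \<inter> (S \<union> W) = T" by (auto simp: dominating_def verts_def)
    then show "2 \<le> card (T \<inter> (S \<union> W))"
      using card_dominating_ge[OF T] r by (simp add: S_def)
  qed
  moreover have "card (S \<union> W) = r + w"
    using disjoint finite by (simp add: card_Un_disjoint S_def W_def)
  moreover have "2 * (r + w) + w + e = 2 * r + 3 * w + e" by simp
  ultimately show ?thesis using F(2) by (simp only: S_def W_def card_lessThan card_atLeastLessThan
      diff_add_inverse)
qed

text \<open>The vertex \<open>0 \<in> S\<close> is joined to all of \<open>W\<close> and to nothing else, and the hubs are joined to
  each other. A dominating set with a hub \<open>c\<close> also contains \<open>0\<close> or some \<open>t \<in> W\<close>, in order to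
  dominate \<open>0\<close>. In the first case all of \<open>W\<close> is overdominated, in the second \<open>a\<close>, \<open>b\<close> and \<open>t\<close>.\<close>

lemma D_CR_ge_adjacent_hubs:
  fixes r w e :: nat
  assumes r: "3 \<le> r" and w: "3 \<le> w" and e: "e \<le> w choose 2"
  shows "r \<le> D_CR (r + w + 2) 2 (2 * r + 3 * w + e - 1)"
proof -
  define S W where "S = {..<r}" and "W = {r..<r + w}"
  define X where "X = S - {0} \<union> W"
  define a b where "a = r + w" and "b = Suc (r + w)"
  have "e \<le> card {x. x \<subseteq> W \<and> card x = 2}" using e by (simp add: n_subsets W_def)
  then obtain F where F: "F \<subseteq> {x. x \<subseteq> W \<and> card x = 2}" "card F = e"
    by (meson obtain_subset_with_card_n)
  have SX: "S \<inter> X = S - {0}" by (auto simp: X_def S_def W_def)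
  have S0: "0 \<in> S" "card (S - {0}) = r - 1" using r by (auto simp: S_def)
  interpret two_hubs S W X "\<lambda>_. 0" "insert {a, b} F" a b
  proof
    show "2 \<le> card (S \<inter> X)" using SX S0 r by simp
  qed (use r F in \<open>auto simp: S_def W_def X_def a_def b_def\<close>)
  have fin: "finite T" if "dominating verts edges T" for T
    using that finite_verts by (auto simp: dominating_def intro: finite_subset)
  have "card S \<le> D_CR (card S + card W + 2) 2 (2 * card X + card W + card (insert {a, b} F))"
  proof (rule two_hubs_D_CR)
    fix T c assume T: "dominating verts edges T" and c: "c \<in> {a, b}" "c \<in> T"
    have "0 \<in> verts" using S0 by (simp add: verts_def)
    then obtain t where t: "t \<in> T" "0 \<in> closed_nbhd edges t"
      using T by (auto simp: dominating_def)
    have "0 \<notin> X" using r by (auto simp: X_def W_def)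
    then consider "t = 0" | "t \<in> W"
      using independent_nbhd[OF S0(1), of t] t closed_nbhd_sym[of t] by auto
    then show "3 \<le> CR_set verts edges T"
    proof cases
      case 1
      have "c \<noteq> 0" using c(1) hubs S0(1) by (metis UnI1 insertE singletonD)
      have "card W \<le> CR_set verts edges T"
      proof (rule CR_set_ge_card[OF finite_verts])
        fix u assume "u \<in> W"
        then show "overdominated edges T u"
          using overdominatedI[OF fin[OF T] c(2) t(1), of edges u] 1 \<open>c \<noteq> 0\<close> W_subset
            hub_joined[OF c(1), of u] joined_parent[of u]
          by (auto simp: mem_closed_nbhd insert_commute)
      qed (auto simp: verts_def)
      then show ?thesis using w by (simp add: W_def)
    next
      case 2
      have ct: "c \<noteq> t" using 2 c hubs by auto
      have ab: "{a, b} \<in> edges" by (simp add: edges_def)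
      have "card {a, b, t} \<le> CR_set verts edges T"
      proof (rule CR_set_ge_card[OF finite_verts])
        show "{a, b, t} \<subseteq> verts" using 2 by (auto simp: verts_def)
        fix u assume "u \<in> {a, b, t}"
        then have "c \<in> closed_nbhd edges u" "t \<in> closed_nbhd edges u"
          using c(1) 2 ab W_subset hub_joined[of a t] hub_joined[of b t]
          by (auto simp: mem_closed_nbhd insert_commute)
        then show "overdominated edges T u"
          by (rule overdominatedI[OF fin[OF T] c(2) t(1) ct])
      qed
      moreover have "a \<noteq> t" "b \<noteq> t" using 2 hubs by auto
      ultimately show ?thesis using hubs by simp
    qed
  next
    fix T assume T: "dominating verts edges T" "a \<notin> T" "b \<notin> T"
    \<comment> \<open>The only neighbours of the vertices of \<open>S - {0}\<close> are the hubs.\<close>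
    have "S - {0} \<subseteq> T"
    proof
      fix s assume s: "s \<in> S - {0}"
      then obtain t where t: "t \<in> T" "s \<in> closed_nbhd edges t"
        using T by (auto simp: dominating_def verts_def)
      then show "s \<in> T"
        using independent_nbhd[of s t] closed_nbhd_sym[of s edges t] s T by auto
    qed
    then have "card (S - {0}) \<le> card (T \<inter> X)"
      using fin[OF T(1)] by (intro card_mono) (auto simp: X_def)
    then show "2 \<le> card (T \<inter> X)" using S0 r by simp
  qed
  moreover have "card X = r - 1 + w"
    unfolding X_def using disjoint finite S0 by (subst card_Un_disjoint) (auto simp: W_def)
  moreover have "card (insert {a, b} F) = Suc e"
  proof -
    have "{a, b} \<notin> F" using F hubs by auto
    moreover have "finite F" using F(1) by (rule finite_subset) (simp add: finite)
    ultimately show ?thesis using F by simp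
  qed
  moreover have "2 * (r - 1 + w) + w + Suc e = 2 * r + 3 * w + e - 1" using r by simp
  ultimately show ?thesis using F(2) by (simp add: S_def W_def)
qed

section \<open>The value of the maximum\<close>

lemma D_CR_le:
  assumes "\<And>V E. simple_graph (V :: nat set) E \<Longrightarrow> card V = n \<Longrightarrow> card E = m \<Longrightarrow>
    CR V E = k \<Longrightarrow> gamma_CR V E \<le> r"
  shows "D_CR n k m \<le> r"
  using assms finite_gamma_CR_values[of n k m]
  by (auto simp: D_CR_def gamma_CR_values_def)

theorem theorem6p6:
  fixes n m r :: nat
  assumes "n \<ge> 8"
    and "m > 2 * (n - 6) + 10"
    and "(2 \<le> r \<and> r < (n - 2) div 2 \<and> edge_bound n (r + 1) + 1 < int m \<and> int m \<le> edge_bound n r + 1) \<or>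
         (r = (n - 2) div 2 \<and> edge_bound n (r + 1) < int m \<and> int m \<le> edge_bound n r + 1) \<or>
         ((n - 2) div 2 < r \<and> r \<le> n - 5 \<and> edge_bound n (r + 1) < int m \<and> int m \<le> edge_bound n r)"
  shows "D_CR n 2 m = r"
proof (rule antisym)
  have r5: "r + 5 \<le> n" and r2: "2 \<le> r" using assms(1,3) by auto
  show "D_CR n 2 m \<le> r"
  proof (rule D_CR_le, rule ccontr)
    fix V :: "nat set" and E
    assume g: "simple_graph V E" "card V = n" "card E = m" "CR V E = 2"
      and "\<not> gamma_CR V E \<le> r"
    then have lt: "r + 1 \<le> gamma_CR V E" by simp
    have "finite V" using g by (simp add: simple_graph_def)
    then have le: "gamma_CR V E \<le> n" using gamma_CR_le_card[of V E] g by simp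
    have anti: "edge_bound n (gamma_CR V E) \<le> edge_bound n (r + 1)"
      using lt le r5 by (intro edge_bound_antimono) auto
    have m: "int m \<le> edge_bound n (r + 1) + 1"
      using card_edges_le(1)[OF g(1,4)] g anti by simp
    then have "(n - 2) div 2 \<le> r" and m': "edge_bound n (r + 1) < int m" using assms(3) by auto
    then have "n < 2 * gamma_CR V E + 2" using lt by linarith
    moreover have "3 \<le> gamma_CR V E" using lt r2 by simp
    ultimately have "int m \<le> edge_bound n (r + 1)"
      using card_edges_le(2)[OF g(1,4)] g anti by simp
    then show False using m' by simp
  qed
  define w where "w = n - r - 2"
  have n: "n = r + w + 2" and w3: "3 \<le> w" using r5 by (auto simp: w_def)
  have choose: "(w + 2) choose 2 = (w choose 2) + 2 * w + 1"
    "(w + 3) choose 2 = (w choose 2) + 3 * w + 3"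
    by (simp_all add: numeral_2_eq_2 numeral_3_eq_3)
  have w_le: "w \<le> w choose 2"
  proof -
    have "w * 2 \<le> w * (w - 1)" using w3 by (intro mult_le_mono) auto
    then have "w * 2 div 2 \<le> w * (w - 1) div 2" by (rule div_le_mono)
    then show ?thesis by (simp add: choose_two)
  qed
  have Ar: "edge_bound n r = 2 * int r - 1 + 3 * int w + int (w choose 2)"
    using choose(2) by (simp add: edge_bound_def n numeral_3_eq_3)
  have Ar1: "edge_bound n (r + 1) = 2 * int r - 1 + 2 * int w + int (w choose 2)"
    using choose(1) by (simp add: edge_bound_def n)
  show "r \<le> D_CR n 2 m"
  proof (cases "r \<le> (n - 2) div 2")
    case True
    then have "int m \<le> edge_bound n r + 1" "edge_bound n (r + 1) < int m" "r \<le> w"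
      using assms(3) n by auto
    \<comment> \<open>The lower bound on \<open>m\<close> gives \<open>m \<ge> 2 * r + 2 * w + (w choose 2)\<close>, which suffices since
      \<open>w \<le> w choose 2\<close>.\<close>
    then have "\<exists>e. m = 2 * r + 3 * w + e \<and> e \<le> w choose 2"
      using w_le unfolding Ar Ar1 by (intro exI[of _ "m - (2 * r + 3 * w)"]) linarith
    then show ?thesis using D_CR_ge_nonadjacent_hubs[OF r2 \<open>r \<le> w\<close>] unfolding n by blast
  next
    case False
    then have "int m \<le> edge_bound n r" "edge_bound n (r + 1) < int m" "3 \<le> r"
      using assms(1,3) by auto
    then have "\<exists>e. m = 2 * r + 3 * w + e - 1 \<and> e \<le> w choose 2"
      using w_le unfolding Ar Ar1 by (intro exI[of _ "m + 1 - (2 * r + 3 * w)"]) linarith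
    then show ?thesis using D_CR_ge_adjacent_hubs[OF \<open>3 \<le> r\<close> w3] unfolding n by blast
  qed
qed

end
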